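(* Let $\mathbb{K}$ be an algebraically closed field of characteristic $0$. Let $\mathcal{H}$ be a Hopf algebra over $\mathbb{K}$ and $e_2$ its unit. Let $\mathcal{H}'$ be the result of adjoining a unit $e_1$ to $\mathcal{H}$ with respect to the multiplication. Extend the comultiplication $\Delta$, counit $\varepsilon$ and antipode $S$ of $\mathcal{H}$ linearly to $\mathcal{H}'$ by $$\Delta(e_1)=(e_1-e_2)\otimes(e_1-e_2)+e_2\otimes e_2,\qquad \varepsilon(e_1)=2,\qquad S(e_1)=e_1.$$ Then $\mathcal{H}'$ becomes a weak Hopf algebra.
   Context: Adjoining a unit $e_1$ to $\mathcal{H}$ means forming $\mathcal{H}'=\mathcal{H}\oplus\mathbb{K}e_1$ with the multiplication extending that of $\mathcal{H}$ for which $e_1$ is the unit. Weak bialgebra. Write $xy=m(x\otimes y)$ and use Sweedler notation $\Delta(x)=x_{(1)}\otimes x_{(2)}$ (summation understood). A weak bialgebra is a quintuple $(V,m,\eta,\Delta,\varepsilon)$ with linear maps $m:V\otimes V\to V$, $\eta:\mathbb{K}\to V$ (write $1=\eta(1)$), $\Delta:V\to V\otimes V$, $\varepsilon:V\to\mathbb{K}$ such that: (1) $(V,m,\eta)$ is a unital associative algebra; (2) $(V,\Delta,\varepsilon)$ is a coassociative counital coalgebra; (3) for all $x,y,z\in V$: $\Delta(xy)=\Delta(x)\bullet\Delta(y)$; $(\Delta\otimes \mathrm{id})\Delta(1)=(\Delta(1)\otimes 1)\bullet(1\otimes\Delta(1))=(1\otimes\Delta(1))\bullet(\Delta(1)\otimes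 1)$; and $\varepsilon(xyz)=\varepsilon(xy_{(1)})\,\varepsilon(y_{(2)}z)$. Here $\bullet$ is the usual componentwise multiplication on tensor powers of $V$. Weak Hopf algebra: a weak bialgebra together with a linear endomorphism $S$ of $V$ (antipode) such that for all $x\in V$: $m(\mathrm{id}\otimes S)\Delta(x)=(\varepsilon\otimes \mathrm{id})(\Delta(1)\bullet(x\otimes 1))$; $m(S\otimes \mathrm{id})\Delta(x)=(\mathrm{id}\otimes\varepsilon)((1\otimes x)\bullet\Delta(1))$; $m(m\otimes \mathrm{id})(S\otimes \mathrm{id}\otimes S)(\Delta\otimes \mathrm{id})\Delta(x)=S(x)$. *)

theory Defs
  imports
    "HOL-Library.Poly_Mapping"
    "HOL-Library.Product_Plus"
    "HOL-Computational_Algebra.Polynomial"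
begin

section \<open>Free vector spaces and their quotients\<close>

definition free_scale :: "'k::field \<Rightarrow> ('a \<Rightarrow>\<^sub>0 'k) \<Rightarrow> ('a \<Rightarrow>\<^sub>0 'k)"
  where "free_scale c p = Poly_Mapping.map ((*) c) p"

lemma lookup_free_scale: "Poly_Mapping.lookup (free_scale c p) a = c * Poly_Mapping.lookup p a"
  by (simp add: free_scale_def Poly_Mapping.map.rep_eq when_def)

lemma vector_space_free_scale: "vector_space (free_scale :: 'k::field \<Rightarrow> ('a \<Rightarrow>\<^sub>0 'k) \<Rightarrow> _)"
  by unfold_locales
    (auto intro!: poly_mapping_eqI simp: lookup_free_scale lookup_add algebra_simps)

definition lin_ext ::
  "('k::field \<Rightarrow> 'w::ab_group_add \<Rightarrow> 'w) \<Rightarrow> ('a \<Rightarrow> 'w) \<Rightarrow> ('a \<Rightarrow>\<^sub>0 'k) \<Rightarrow> 'w"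
  where "lin_ext s f p = (\<Sum>a\<in>Poly_Mapping.keys p. s (Poly_Mapping.lookup p a) (f a))"

text \<open>
  A quotient of a free vector space by a subspace \<open>N\<close> is the set of cosets of \<open>N\<close>. Since the
  tensor products below depend on the scalar multiplication of the underlying space (a term), they
  are such sets and not types. Operations on them are computed on the representatives
  \<open>rep X\<close>; for maps that respect \<open>N\<close> the choice is irrelevant (see
  \<open>eval2_coset\<close> below).
\<close>

definition coset :: "('a \<Rightarrow>\<^sub>0 'k::field) set \<Rightarrow> ('a \<Rightarrow>\<^sub>0 'k) \<Rightarrow> ('a \<Rightarrow>\<^sub>0 'k) set"
  where "coset N p = {q. q - p \<in> N}"

definition quot :: "('a \<Rightarrow>\<^sub>0 'k::field) set \<Rightarrow> ('a \<Rightarrow>\<^sub>0 'k) set set"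
  where "quot N = range (coset N)"

definition rep :: "('a \<Rightarrow>\<^sub>0 'k::field) set \<Rightarrow> ('a \<Rightarrow>\<^sub>0 'k)"
  where "rep X = (SOME p. p \<in> X)"

definition quot_add ::
  "('a \<Rightarrow>\<^sub>0 'k::field) set \<Rightarrow> ('a \<Rightarrow>\<^sub>0 'k) set \<Rightarrow> ('a \<Rightarrow>\<^sub>0 'k) set \<Rightarrow> ('a \<Rightarrow>\<^sub>0 'k) set"
  where "quot_add N X Y = coset N (rep X + rep Y)"

definition quot_scale ::
  "('a \<Rightarrow>\<^sub>0 'k::field) set \<Rightarrow> 'k \<Rightarrow> ('a \<Rightarrow>\<^sub>0 'k) set \<Rightarrow> ('a \<Rightarrow>\<^sub>0 'k) set"
  where "quot_scale N c X = coset N (free_scale c (rep X))"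

text \<open>
  Linear maps out of a quotient, given by their values on the generators: with values in a vector
  space (\<open>lift_val\<close>) and with values in another quotient, by \<open>N\<close> (\<open>lift_quot\<close>).
\<close>

definition lift_val ::
  "('k::field \<Rightarrow> 'w::ab_group_add \<Rightarrow> 'w) \<Rightarrow> ('a \<Rightarrow> 'w) \<Rightarrow> ('a \<Rightarrow>\<^sub>0 'k) set \<Rightarrow> 'w"
  where "lift_val s f X = lin_ext s f (rep X)"

definition lift_quot ::
  "('b \<Rightarrow>\<^sub>0 'k::field) set \<Rightarrow> ('a \<Rightarrow> ('b \<Rightarrow>\<^sub>0 'k) set) \<Rightarrow> ('a \<Rightarrow>\<^sub>0 'k) set \<Rightarrow> ('b \<Rightarrow>\<^sub>0 'k) set"
  where "lift_quot N f X = coset N (lin_ext free_scale (\<lambda>a. rep (f a)) (rep X))"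


section \<open>The tensor powers \<open>V \<otimes> V\<close> and \<open>V \<otimes> V \<otimes> V\<close>\<close>

abbreviation gen :: "'a \<Rightarrow> ('a \<Rightarrow>\<^sub>0 'k::field)"
  where "gen a \<equiv> Poly_Mapping.single a 1"

definition null2 :: "('k::field \<Rightarrow> 'v::ab_group_add \<Rightarrow> 'v) \<Rightarrow> ('v \<times> 'v \<Rightarrow>\<^sub>0 'k) set"
  where "null2 s = module.span free_scale
    ({gen (s c x + x', y) - free_scale c (gen (x, y)) - gen (x', y) | c x x' y. True} \<union>
     {gen (x, s c y + y') - free_scale c (gen (x, y)) - gen (x, y') | c x y y'. True})"

definition null3 :: "('k::field \<Rightarrow> 'v::ab_group_add \<Rightarrow> 'v) \<Rightarrow> ('v \<times> 'v \<times> 'v \<Rightarrow>\<^sub>0 'k) set"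
  where "null3 s = module.span free_scale
    ({gen (s c x + x', y, z) - free_scale c (gen (x, y, z)) - gen (x', y, z) | c x x' y z. True} \<union>
     {gen (x, s c y + y', z) - free_scale c (gen (x, y, z)) - gen (x, y', z) | c x y y' z. True} \<union>
     {gen (x, y, s c z + z') - free_scale c (gen (x, y, z)) - gen (x, y, z') | c x y z z'. True})"

abbreviation tensor2 :: "('k::field \<Rightarrow> 'v::ab_group_add \<Rightarrow> 'v) \<Rightarrow> ('v \<times> 'v \<Rightarrow>\<^sub>0 'k) set set"
  where "tensor2 s \<equiv> quot (null2 s)"

definition pure2 ::
  "('k::field \<Rightarrow> 'v::ab_group_add \<Rightarrow> 'v) \<Rightarrow> 'v \<Rightarrow> 'v \<Rightarrow> ('v \<times> 'v \<Rightarrow>\<^sub>0 'k) set"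
  where "pure2 s x y = coset (null2 s) (gen (x, y))"

definition pure3 ::
  "('k::field \<Rightarrow> 'v::ab_group_add \<Rightarrow> 'v) \<Rightarrow> 'v \<Rightarrow> 'v \<Rightarrow> 'v \<Rightarrow> ('v \<times> 'v \<times> 'v \<Rightarrow>\<^sub>0 'k) set"
  where "pure3 s x y z = coset (null3 s) (gen (x, y, z))"

abbreviation eval2 ::
  "('k::field \<Rightarrow> 'w::ab_group_add \<Rightarrow> 'w) \<Rightarrow> ('v \<Rightarrow> 'v \<Rightarrow> 'w) \<Rightarrow> ('v \<times> 'v \<Rightarrow>\<^sub>0 'k) set \<Rightarrow> 'w"
  where "eval2 sw f \<equiv> lift_val sw (\<lambda>(x, y). f x y)"

abbreviation eval3 ::
  "('k::field \<Rightarrow> 'w::ab_group_add \<Rightarrow> 'w) \<Rightarrow> ('v \<Rightarrow> 'v \<Rightarrow> 'v \<Rightarrow> 'w)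
    \<Rightarrow> ('v \<times> 'v \<times> 'v \<Rightarrow>\<^sub>0 'k) set \<Rightarrow> 'w"
  where "eval3 sw f \<equiv> lift_val sw (\<lambda>(x, y, z). f x y z)"

text \<open>\<open>append_right s X z\<close> is \<open>X \<otimes> z\<close> and \<open>append_left s x Y\<close> is \<open>x \<otimes> Y\<close>, for \<open>X, Y\<close> in
  \<open>V \<otimes> V\<close>.\<close>

definition append_right ::
  "('k::field \<Rightarrow> 'v::ab_group_add \<Rightarrow> 'v) \<Rightarrow> ('v \<times> 'v \<Rightarrow>\<^sub>0 'k) set \<Rightarrow> 'v \<Rightarrow> ('v \<times> 'v \<times> 'v \<Rightarrow>\<^sub>0 'k) set"
  where "append_right s X z = lift_quot (null3 s) (\<lambda>(x, y). pure3 s x y z) X"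

definition append_left ::
  "('k::field \<Rightarrow> 'v::ab_group_add \<Rightarrow> 'v) \<Rightarrow> 'v \<Rightarrow> ('v \<times> 'v \<Rightarrow>\<^sub>0 'k) set \<Rightarrow> ('v \<times> 'v \<times> 'v \<Rightarrow>\<^sub>0 'k) set"
  where "append_left s x Y = lift_quot (null3 s) (\<lambda>(y, z). pure3 s x y z) Y"

text \<open>\<open>D \<otimes> id\<close> and \<open>id \<otimes> D\<close> for a linear map \<open>D\<close> from \<open>V\<close> to \<open>V \<otimes> V\<close>.\<close>

definition tensor_id_right ::
  "('k::field \<Rightarrow> 'v::ab_group_add \<Rightarrow> 'v) \<Rightarrow> ('v \<Rightarrow> ('v \<times> 'v \<Rightarrow>\<^sub>0 'k) set)
    \<Rightarrow> ('v \<times> 'v \<Rightarrow>\<^sub>0 'k) set \<Rightarrow> ('v \<times> 'v \<times> 'v \<Rightarrow>\<^sub>0 'k) set"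
  where "tensor_id_right s D X = lift_quot (null3 s) (\<lambda>(x, y). append_right s (D x) y) X"

definition tensor_id_left ::
  "('k::field \<Rightarrow> 'v::ab_group_add \<Rightarrow> 'v) \<Rightarrow> ('v \<Rightarrow> ('v \<times> 'v \<Rightarrow>\<^sub>0 'k) set)
    \<Rightarrow> ('v \<times> 'v \<Rightarrow>\<^sub>0 'k) set \<Rightarrow> ('v \<times> 'v \<times> 'v \<Rightarrow>\<^sub>0 'k) set"
  where "tensor_id_left s D X = lift_quot (null3 s) (\<lambda>(x, y). append_left s x (D y)) X"

text \<open>The componentwise multiplications.\<close>

definition mult2 ::
  "('k::field \<Rightarrow> 'v::ab_group_add \<Rightarrow> 'v) \<Rightarrow> ('v \<Rightarrow> 'v \<Rightarrow> 'v)
    \<Rightarrow> ('v \<times> 'v \<Rightarrow>\<^sub>0 'k) set \<Rightarrow> ('v \<times> 'v \<Rightarrow>\<^sub>0 'k) set \<Rightarrow> ('v \<times> 'v \<Rightarrow>\<^sub>0 'k) set"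
  where "mult2 s m X Y = lift_quot (null2 s) (\<lambda>(x, y).
    lift_quot (null2 s) (\<lambda>(x', y'). pure2 s (m x x') (m y y')) Y) X"

definition mult3 ::
  "('k::field \<Rightarrow> 'v::ab_group_add \<Rightarrow> 'v) \<Rightarrow> ('v \<Rightarrow> 'v \<Rightarrow> 'v)
    \<Rightarrow> ('v \<times> 'v \<times> 'v \<Rightarrow>\<^sub>0 'k) set \<Rightarrow> ('v \<times> 'v \<times> 'v \<Rightarrow>\<^sub>0 'k) set \<Rightarrow> ('v \<times> 'v \<times> 'v \<Rightarrow>\<^sub>0 'k) set"
  where "mult3 s m X Y = lift_quot (null3 s) (\<lambda>(x, y, z).
    lift_quot (null3 s) (\<lambda>(x', y', z'). pure3 s (m x x') (m y y') (m z z')) Y) X"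

text \<open>The universal property of \<open>V \<otimes> V\<close>: for bilinear \<open>f\<close>, \<open>eval2\<close> does not depend on
  representatives.\<close>

lemma lin_ext_linear:
  fixes s :: "'k::field \<Rightarrow> 'w::ab_group_add \<Rightarrow> 'w" and f :: "'a \<Rightarrow> 'w"
  assumes "vector_space s"
  shows "Vector_Spaces.linear free_scale s (lin_ext s f)"
proof -
  interpret W: vector_space s by fact
  have on: "lin_ext s f p = (\<Sum>a\<in>A. s (Poly_Mapping.lookup p a) (f a))"
    if "finite A" "Poly_Mapping.keys p \<subseteq> A" for p :: "'a \<Rightarrow>\<^sub>0 'k" and A
    unfolding lin_ext_def by (rule sum.mono_neutral_left) (use that in \<open>auto simp: in_keys_iff\<close>)
  show ?thesis
    unfolding Vector_Spaces.linear_iff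
  proof (intro conjI allI vector_space_free_scale assms)
    fix p q :: "'a \<Rightarrow>\<^sub>0 'k"
    let ?A = "Poly_Mapping.keys p \<union> Poly_Mapping.keys q"
    have "Poly_Mapping.keys (p + q) \<subseteq> ?A" by (rule Poly_Mapping.keys_add)
    then show "lin_ext s f (p + q) = lin_ext s f p + lin_ext s f q"
      using on[of ?A p] on[of ?A q] on[of ?A "p + q"]
      by (simp add: lookup_add W.scale_left_distrib sum.distrib)
  next
    fix c and p :: "'a \<Rightarrow>\<^sub>0 'k"
    have "Poly_Mapping.keys (free_scale c p) \<subseteq> Poly_Mapping.keys p"
      by (auto simp: in_keys_iff lookup_free_scale)
    then show "lin_ext s f (free_scale c p) = s c (lin_ext s f p)"
      using on[of "Poly_Mapping.keys p" p] on[of "Poly_Mapping.keys p" "free_scale c p"]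
      by (simp add: lookup_free_scale W.scale_sum_right)
  qed
qed

lemma lin_ext_gen: "vector_space s \<Longrightarrow> lin_ext s f (gen a) = f a"
  by (simp add: lin_ext_def vector_space_def)

lemma eval2_coset:
  fixes s :: "'k::field \<Rightarrow> 'v::ab_group_add \<Rightarrow> 'v" and sw :: "'k \<Rightarrow> 'w::ab_group_add \<Rightarrow> 'w"
  assumes "vector_space s" and "vector_space sw"
    and lin1: "\<And>y. Vector_Spaces.linear s sw (\<lambda>x. f x y)"
    and lin2: "\<And>x. Vector_Spaces.linear s sw (f x)"
  shows "eval2 sw f (coset (null2 s) p) = lin_ext sw (\<lambda>(x, y). f x y) p"
proof -
  interpret F: vector_space "free_scale :: 'k \<Rightarrow> ('v \<times> 'v \<Rightarrow>\<^sub>0 'k) \<Rightarrow> _"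
    by (rule vector_space_free_scale)
  interpret W: vector_space sw by fact
  let ?e = "lin_ext sw (\<lambda>(x, y). f x y)"
  interpret e: Vector_Spaces.linear free_scale sw ?e
    by (rule lin_ext_linear) fact
  interpret l1: Vector_Spaces.linear s sw "\<lambda>x. f x y" for y by (rule lin1)
  interpret l2: Vector_Spaces.linear s sw "f x" for x by (rule lin2)
  have null: "?e q = 0" if "q \<in> null2 s" for q
    using that unfolding null2_def
    by (induction q rule: F.span_induct)
      (auto simp: F.subspace_def e.add e.scale e.diff e.zero lin_ext_gen[OF \<open>vector_space sw\<close>]
        l1.add l1.scale l2.add l2.scale)
  have "p \<in> coset (null2 s) p"
    by (simp add: coset_def null2_def F.span_zero)
  then have "rep (coset (null2 s) p) \<in> coset (null2 s) p"
    unfolding rep_def by (rule someI)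
  then have "?e (rep (coset (null2 s) p) - p) = 0"
    by (simp add: coset_def null)
  then show ?thesis
    by (simp add: lift_val_def e.diff)
qed


section \<open>Bialgebras, weak bialgebras, Hopf algebras and weak Hopf algebras\<close>

text \<open>The multiplication is given as a bilinear map and the unit map by its value \<open>e\<close> at \<open>1\<close>.\<close>

locale unital_algebra = vector_space s
  for s :: "'k::field \<Rightarrow> 'v::ab_group_add \<Rightarrow> 'v" +
  fixes m :: "'v \<Rightarrow> 'v \<Rightarrow> 'v" and e :: 'v
  assumes mult_linear_left: "Vector_Spaces.linear s s (\<lambda>x. m x y)"
    and mult_linear_right: "Vector_Spaces.linear s s (m x)"
    and mult_assoc: "m (m x y) z = m x (m y z)"
    and mult_unit_left: "m e x = x"
    and mult_unit_right: "m x e = x"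

locale counital_coalgebra = vector_space s
  for s :: "'k::field \<Rightarrow> 'v::ab_group_add \<Rightarrow> 'v" +
  fixes \<Delta> :: "'v \<Rightarrow> ('v \<times> 'v \<Rightarrow>\<^sub>0 'k) set" and \<epsilon> :: "'v \<Rightarrow> 'k"
  assumes comult_closed: "\<Delta> x \<in> tensor2 s"
    and comult_add: "\<Delta> (x + y) = quot_add (null2 s) (\<Delta> x) (\<Delta> y)"
    and comult_scale: "\<Delta> (s c x) = quot_scale (null2 s) c (\<Delta> x)"
    and counit_linear: "Vector_Spaces.linear s (*) \<epsilon>"
    and coassoc: "tensor_id_right s \<Delta> (\<Delta> x) = tensor_id_left s \<Delta> (\<Delta> x)"
    and counit_left: "eval2 s (\<lambda>a b. s (\<epsilon> a) b) (\<Delta> x) = x"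
    and counit_right: "eval2 s (\<lambda>a b. s (\<epsilon> b) a) (\<Delta> x) = x"

locale bialgebra = unital_algebra s m e + counital_coalgebra s \<Delta> \<epsilon>
  for s :: "'k::field \<Rightarrow> 'v::ab_group_add \<Rightarrow> 'v" and m e \<Delta> \<epsilon> +
  assumes comult_mult: "\<Delta> (m x y) = mult2 s m (\<Delta> x) (\<Delta> y)"
    and comult_unit: "\<Delta> e = pure2 s e e"
    and counit_mult: "\<epsilon> (m x y) = \<epsilon> x * \<epsilon> y"
    and counit_unit: "\<epsilon> e = 1"

locale hopf_algebra = bialgebra s m e \<Delta> \<epsilon>
  for s :: "'k::field \<Rightarrow> 'v::ab_group_add \<Rightarrow> 'v" and m e \<Delta> \<epsilon> +
  fixes S :: "'v \<Rightarrow> 'v"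
  assumes antipode_linear: "Vector_Spaces.linear s s S"
    and antipode_left: "eval2 s (\<lambda>a b. m (S a) b) (\<Delta> x) = s (\<epsilon> x) e"
    and antipode_right: "eval2 s (\<lambda>a b. m a (S b)) (\<Delta> x) = s (\<epsilon> x) e"

locale weak_bialgebra = unital_algebra s m e + counital_coalgebra s \<Delta> \<epsilon>
  for s :: "'k::field \<Rightarrow> 'v::ab_group_add \<Rightarrow> 'v" and m e \<Delta> \<epsilon> +
  assumes weak_comult_mult: "\<Delta> (m x y) = mult2 s m (\<Delta> x) (\<Delta> y)"
    and weak_comult_unit1: "tensor_id_right s \<Delta> (\<Delta> e) =
      mult3 s m (append_right s (\<Delta> e) e) (append_left s e (\<Delta> e))"
    and weak_comult_unit2: "tensor_id_right s \<Delta> (\<Delta> e) =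
      mult3 s m (append_left s e (\<Delta> e)) (append_right s (\<Delta> e) e)"
    and weak_counit_mult: "\<epsilon> (m (m x y) z) = eval2 (*) (\<lambda>a b. \<epsilon> (m x a) * \<epsilon> (m b z)) (\<Delta> y)"

locale weak_hopf_algebra = weak_bialgebra s m e \<Delta> \<epsilon>
  for s :: "'k::field \<Rightarrow> 'v::ab_group_add \<Rightarrow> 'v" and m e \<Delta> \<epsilon> +
  fixes S :: "'v \<Rightarrow> 'v"
  assumes weak_antipode_linear: "Vector_Spaces.linear s s S"
    and weak_antipode_right: "eval2 s (\<lambda>a b. m a (S b)) (\<Delta> x) =
      eval2 s (\<lambda>a b. s (\<epsilon> a) b) (mult2 s m (\<Delta> e) (pure2 s x e))"
    and weak_antipode_left: "eval2 s (\<lambda>a b. m (S a) b) (\<Delta> x) =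
      eval2 s (\<lambda>a b. s (\<epsilon> b) a) (mult2 s m (pure2 s e x) (\<Delta> e))"
    and weak_antipode_triple:
      "eval3 s (\<lambda>a b c. m (m (S a) b) (S c)) (tensor_id_right s \<Delta> (\<Delta> x)) = S x"


section \<open>Adjoining a unit\<close>

text \<open>
  The pair \<open>(x, a)\<close> stands for \<open>x + a e\<^sub>1\<close> in \<open>H \<oplus> K e\<^sub>1\<close>; thus \<open>e\<^sub>1 = (0, 1)\<close>, and
  \<open>incl\<close> embeds \<open>H\<close>. The extension of a map on \<open>H\<close> is \<open>(x, a) \<mapsto> f x + a f(e\<^sub>1)\<close> with the
  value at \<open>e\<^sub>1\<close> prescribed.
\<close>

definition adj_scale :: "('k::field \<Rightarrow> 'v::ab_group_add \<Rightarrow> 'v) \<Rightarrow> 'k \<Rightarrow> 'v \<times> 'k \<Rightarrow> 'v \<times> 'k"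
  where "adj_scale s c = (\<lambda>(x, a). (s c x, c * a))"

definition adj_mult ::
  "('k::field \<Rightarrow> 'v::ab_group_add \<Rightarrow> 'v) \<Rightarrow> ('v \<Rightarrow> 'v \<Rightarrow> 'v) \<Rightarrow> 'v \<times> 'k \<Rightarrow> 'v \<times> 'k \<Rightarrow> 'v \<times> 'k"
  where "adj_mult s m = (\<lambda>(x, a) (y, b). (m x y + s a y + s b x, a * b))"

definition adj_unit :: "'v::ab_group_add \<times> 'k::field"
  where "adj_unit = (0, 1)"

definition incl :: "'v::ab_group_add \<Rightarrow> 'v \<times> 'k::field"
  where "incl x = (x, 0)"

definition incl2 ::
  "('k::field \<Rightarrow> 'v::ab_group_add \<Rightarrow> 'v) \<Rightarrow> ('v \<times> 'v \<Rightarrow>\<^sub>0 'k) set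
    \<Rightarrow> (('v \<times> 'k) \<times> ('v \<times> 'k) \<Rightarrow>\<^sub>0 'k) set"
  where "incl2 s X =
    lift_quot (null2 (adj_scale s)) (\<lambda>(x, y). pure2 (adj_scale s) (incl x) (incl y)) X"

definition adj_comult_unit ::
  "('k::field \<Rightarrow> 'v::ab_group_add \<Rightarrow> 'v) \<Rightarrow> 'v \<Rightarrow> (('v \<times> 'k) \<times> ('v \<times> 'k) \<Rightarrow>\<^sub>0 'k) set"
  where "adj_comult_unit s e\<^sub>2 = quot_add (null2 (adj_scale s))
    (pure2 (adj_scale s) (adj_unit - incl e\<^sub>2) (adj_unit - incl e\<^sub>2))
    (pure2 (adj_scale s) (incl e\<^sub>2) (incl e\<^sub>2))"

definition adj_comult ::
  "('k::field \<Rightarrow> 'v::ab_group_add \<Rightarrow> 'v) \<Rightarrow> 'v \<Rightarrow> ('v \<Rightarrow> ('v \<times> 'v \<Rightarrow>\<^sub>0 'k) set)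
    \<Rightarrow> 'v \<times> 'k \<Rightarrow> (('v \<times> 'k) \<times> ('v \<times> 'k) \<Rightarrow>\<^sub>0 'k) set"
  where "adj_comult s e\<^sub>2 \<Delta> = (\<lambda>(x, a). quot_add (null2 (adj_scale s)) (incl2 s (\<Delta> x))
    (quot_scale (null2 (adj_scale s)) a (adj_comult_unit s e\<^sub>2)))"

definition adj_counit :: "('v \<Rightarrow> 'k::field) \<Rightarrow> 'v \<times> 'k \<Rightarrow> 'k"
  where "adj_counit \<epsilon> = (\<lambda>(x, a). \<epsilon> x + a * 2)"

definition adj_antipode ::
  "('k::field \<Rightarrow> 'v::ab_group_add \<Rightarrow> 'v) \<Rightarrow> ('v \<Rightarrow> 'v) \<Rightarrow> 'v \<times> 'k \<Rightarrow> 'v \<times> 'k"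
  where "adj_antipode s S = (\<lambda>(x, a). incl (S x) + adj_scale s a adj_unit)"

end

theory Submission
  imports Defs
begin

text \<open>
  Let \<open>e\<^sub>0 = e\<^sub>1 - e\<^sub>2\<close>. Since \<open>e\<^sub>2\<close> is the unit of \<open>H\<close>, the element \<open>e\<^sub>0\<close> is an idempotent with
  \<open>e\<^sub>0 H = H e\<^sub>0 = 0\<close>, so the algebra with the adjoined unit is the direct sum of \<open>H\<close> and the ground field
  \<open>K e\<^sub>0\<close>. The prescriptions for \<open>e\<^sub>1\<close> say precisely that \<open>\<Delta>(e\<^sub>0) = e\<^sub>0 \<otimes> e\<^sub>0\<close>,
  \<open>\<epsilon>(e\<^sub>0) = 2 - 1 = 1\<close> and \<open>S(e\<^sub>0) = e\<^sub>0\<close>, that is, that \<open>K e\<^sub>0\<close> is the trivial Hopf algebra and that all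
  structure maps act componentwise. A direct sum of two Hopf algebras satisfies the axioms
  of a weak Hopf algebra: each axiom holds on both summands, and mixed terms vanish. It is not a
  bialgebra, since \<open>\<Delta>(1) = e\<^sub>2 \<otimes> e\<^sub>2 + e\<^sub>0 \<otimes> e\<^sub>0\<close> differs from \<open>1 \<otimes> 1\<close>.

  The coordinates \<open>x + a e\<^sub>0\<close> are called \<open>dsum x a\<close> below; \<open>adj_mult_dsum\<close>,
  \<open>adj_counit_dsum\<close>, \<open>adj_antipode_dsum\<close> and above all \<open>eval2_adj_comult_dsum\<close> say that the
  structure maps split.

  Tensors are cosets here, and computing with representatives is avoided by a form of Sweedler
  calculus. Linear forms separate the points of a quotient space (\<open>quot_eqI\<close>), so an equation between
  tensors may be checked on all scalar-valued multilinear forms (\<open>tensor2_eqI\<close>,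
  \<open>tensor3_eqI\<close>). Evaluating such a form on a tensor built by the operations on tensors reduces to
  iterated evaluations on the pieces (\<open>lift_val_lift_quot\<close> and its instances), and there the
  splitting of \<open>\<Delta>\<close> applies.
\<close>

section \<open>Maps out of quotients of free vector spaces\<close>

text \<open>
  Compatibility of \<open>f\<close> with a space \<open>N\<close> of relations: its linear extension factors through the
  quotient by \<open>N\<close>, and \<open>lift_val\<close> may be computed on any representative.
\<close>

definition descends ::
  "('a \<Rightarrow>\<^sub>0 'k::field) set \<Rightarrow> ('k \<Rightarrow> 'w::ab_group_add \<Rightarrow> 'w) \<Rightarrow> ('a \<Rightarrow> 'w) \<Rightarrow> bool"
  where "descends N sw f \<longleftrightarrow> vector_space sw \<and> (\<forall>q\<in>N. lin_ext sw f q = 0)"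

abbreviation free_subspace :: "('a \<Rightarrow>\<^sub>0 'k::field) set \<Rightarrow> bool"
  where "free_subspace \<equiv> module.subspace free_scale"

lemma vector_space_field: "vector_space ((*) :: 'k::field \<Rightarrow> 'k \<Rightarrow> 'k)"
  by unfold_locales (auto simp: algebra_simps)

lemma coset_rep:
  fixes N :: "('a \<Rightarrow>\<^sub>0 'k::field) set"
  assumes "free_subspace N" "X \<in> quot N"
  shows "X = coset N (rep X)"
proof -
  interpret F: vector_space "free_scale :: 'k \<Rightarrow> ('a \<Rightarrow>\<^sub>0 'k) \<Rightarrow> _"
    by (rule vector_space_free_scale)
  obtain p where X: "X = coset N p"
    using assms(2) by (auto simp: quot_def)
  have "p \<in> X"
    using assms(1) by (simp add: X coset_def F.subspace_0)
  then have "rep X \<in> X"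
    unfolding rep_def by (rule someI)
  then have "rep X - p \<in> N"
    by (simp add: X coset_def)
  then have "q - p \<in> N \<longleftrightarrow> q - rep X \<in> N" for q
    using F.subspace_add[OF assms(1), of "q - rep X" "rep X - p"]
      F.subspace_diff[OF assms(1), of "q - p" "rep X - p"] by auto
  then have "coset N (rep X) = coset N p"
    unfolding coset_def by blast
  then show ?thesis
    by (metis X)
qed

lemma lift_val_coset:
  assumes "free_subspace N" "descends N sw f"
  shows "lift_val sw f (coset N p) = lin_ext sw f p"
proof -
  interpret e: Vector_Spaces.linear free_scale sw "lin_ext sw f"
    by (rule lin_ext_linear) (use assms in \<open>simp add: descends_def\<close>)
  have "coset N p \<in> quot N"
    by (simp add: quot_def)
  then have "p \<in> coset N (rep (coset N p))"
    using coset_rep[OF assms(1)] assms(1) e.vs1.subspace_0 by (force simp: coset_def)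
  then have "lin_ext sw f (p - rep (coset N p)) = 0"
    using assms(2) by (simp add: coset_def descends_def)
  then show ?thesis
    by (simp add: lift_val_def e.diff)
qed

lemma linear_lin_ext:
  assumes "Vector_Spaces.linear s1 s2 h"
  shows "h (lin_ext s1 f p) = lin_ext s2 (\<lambda>a. h (f a)) p"
proof -
  interpret Vector_Spaces.linear s1 s2 h by fact
  show ?thesis by (simp add: lin_ext_def sum scale)
qed

lemma linear_lift_val:
  "Vector_Spaces.linear s1 s2 h \<Longrightarrow> h (lift_val s1 f X) = lift_val s2 (\<lambda>a. h (f a)) X"
  by (simp add: lift_val_def linear_lin_ext)

text \<open>
  Only \<open>f\<close> has to be compatible with the relations: the left-hand side is one linear extension
  applied to the representative \<open>rep X\<close>, and the right-hand side uses that same representative. So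
  nested tensor constructions can be evaluated without first proving that the maps \<open>g\<close> from which
  they are built are multilinear.
\<close>

lemma lift_val_lift_quot:
  assumes "free_subspace N" "descends N sw f"
  shows "lift_val sw f (lift_quot N g X) = lift_val sw (\<lambda>a. lift_val sw f (g a)) X"
proof -
  have "Vector_Spaces.linear free_scale sw (lin_ext sw f)"
    by (rule lin_ext_linear) (use assms in \<open>simp add: descends_def\<close>)
  then show ?thesis
    by (simp add: lift_quot_def lift_val_coset[OF assms] linear_lin_ext) (simp add: lift_val_def)
qed

lemma lift_val_quot_add:
  assumes "free_subspace N" "descends N sw f"
  shows "lift_val sw f (quot_add N X Y) = lift_val sw f X + lift_val sw f Y"
proof -
  interpret e: Vector_Spaces.linear free_scale sw "lin_ext sw f"
    by (rule lin_ext_linear) (use assms in \<open>simp add: descends_def\<close>)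
  show ?thesis
    by (simp add: quot_add_def lift_val_coset[OF assms] e.add) (simp add: lift_val_def)
qed

lemma lift_val_quot_scale:
  assumes "free_subspace N" "descends N sw f"
  shows "lift_val sw f (quot_scale N c X) = sw c (lift_val sw f X)"
proof -
  interpret e: Vector_Spaces.linear free_scale sw "lin_ext sw f"
    by (rule lin_ext_linear) (use assms in \<open>simp add: descends_def\<close>)
  show ?thesis
    by (simp add: quot_scale_def lift_val_coset[OF assms] e.scale) (simp add: lift_val_def)
qed

lemma lift_val_add:
  assumes "vector_space sw"
  shows "lift_val sw (\<lambda>a. f a + g a) X = lift_val sw f X + lift_val sw g X"
proof -
  interpret vector_space sw by fact
  show ?thesis by (simp add: lift_val_def lin_ext_def scale_right_distrib sum.distrib)
qed

text \<open>
  Over a field the linear forms on a quotient space separate its points: if the difference \<open>d\<close> of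
  two representatives were outside \<open>N\<close>, a basis of \<open>N\<close> could be extended by \<open>d\<close>, and some linear form
  would vanish on \<open>N\<close> and take the value \<open>1\<close> at \<open>d\<close>.
\<close>

lemma quot_eqI:
  fixes N :: "('a \<Rightarrow>\<^sub>0 'k::field) set"
  assumes N: "free_subspace N" and X: "X \<in> quot N" and Y: "Y \<in> quot N"
    and eq: "\<And>f :: 'a \<Rightarrow> 'k. descends N (*) f \<Longrightarrow> lift_val (*) f X = lift_val (*) f Y"
  shows "X = Y"
proof -
  interpret F: vector_space "free_scale :: 'k \<Rightarrow> ('a \<Rightarrow>\<^sub>0 'k) \<Rightarrow> _"
    by (rule vector_space_free_scale)
  interpret K: vector_space "(*) :: 'k \<Rightarrow> 'k \<Rightarrow> 'k"
    by (rule vector_space_field)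
  interpret FK: vector_space_pair "free_scale :: 'k \<Rightarrow> ('a \<Rightarrow>\<^sub>0 'k) \<Rightarrow> _" "(*) :: 'k \<Rightarrow> 'k \<Rightarrow> 'k" ..
  define d where "d = rep X - rep Y"
  have "d \<in> N"
  proof (rule ccontr)
    assume "d \<notin> N"
    obtain B where B: "B \<subseteq> N" "F.independent B" "N \<subseteq> F.span B"
      by (rule F.maximal_independent_subset)
    have span: "F.span B = N"
      using B F.span_minimal[OF B(1) N] by blast
    then have "F.independent (insert d B)"
      using \<open>d \<notin> N\<close> B(2) by (intro F.independent_insertI) auto
    then obtain h where h: "Vector_Spaces.linear free_scale (*) h"
        "\<And>b. b \<in> insert d B \<Longrightarrow> h b = (if b = d then 1 else 0)"
      using FK.linear_independent_extend[of "insert d B" "\<lambda>b. if b = d then 1 else 0"] by blast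
    interpret h: Vector_Spaces.linear free_scale "(*)" h by (rule h(1))
    have "d \<notin> B"
      using \<open>d \<notin> N\<close> B(1) by blast
    then have h_0: "h q = 0" if "q \<in> N" for q
      using that \<open>d \<notin> B\<close> h(2) span by (intro h.eq_0_on_span[of B q]) auto
    \<comment> \<open>a linear form on the free space is the extension of its values on the generators\<close>
    have h_ext: "lin_ext (*) (\<lambda>a. h (gen a)) p = h p" for p
    proof -
      have "lin_ext free_scale gen p = p"
        by (rule poly_mapping_eqI)
          (auto simp: lin_ext_def lookup_sum lookup_free_scale lookup_single when_def
            if_distrib in_keys_iff sum.delta cong: if_cong)
      then show ?thesis
        using linear_lin_ext[OF h(1), of gen p] by simp
    qed
    have "descends N (*) (\<lambda>a. h (gen a))"
      by (simp add: descends_def K.vector_space_axioms h_ext h_0)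
    from eq[OF this] have "h d = 0"
      by (simp add: d_def h.diff lift_val_def h_ext)
    then show False
      using h(2)[of d] by simp
  qed
  then have "q - rep X \<in> N \<longleftrightarrow> q - rep Y \<in> N" for q
    using F.subspace_add[OF N, of "q - rep X" d] F.subspace_diff[OF N, of "q - rep Y" d]
    by (auto simp: d_def)
  then have "coset N (rep X) = coset N (rep Y)"
    by (simp add: coset_def)
  then show ?thesis
    using coset_rep[OF N X] coset_rep[OF N Y] by simp
qed

section \<open>Multilinear maps and the tensor relations\<close>

definition bilinear ::
  "('k::field \<Rightarrow> 'v::ab_group_add \<Rightarrow> 'v) \<Rightarrow> ('k \<Rightarrow> 'w::ab_group_add \<Rightarrow> 'w) \<Rightarrow> ('v \<Rightarrow> 'v \<Rightarrow> 'w) \<Rightarrow> bool"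
  where "bilinear s sw f \<longleftrightarrow>
    (\<forall>y. Vector_Spaces.linear s sw (\<lambda>x. f x y)) \<and> (\<forall>x. Vector_Spaces.linear s sw (f x))"

definition trilinear ::
  "('k::field \<Rightarrow> 'v::ab_group_add \<Rightarrow> 'v) \<Rightarrow> ('k \<Rightarrow> 'w::ab_group_add \<Rightarrow> 'w)
    \<Rightarrow> ('v \<Rightarrow> 'v \<Rightarrow> 'v \<Rightarrow> 'w) \<Rightarrow> bool"
  where "trilinear s sw f \<longleftrightarrow>
    (\<forall>y z. Vector_Spaces.linear s sw (\<lambda>x. f x y z)) \<and>
    (\<forall>x z. Vector_Spaces.linear s sw (\<lambda>y. f x y z)) \<and>
    (\<forall>x y. Vector_Spaces.linear s sw (f x y))"

text \<open>
  The relations that generate \<open>null2\<close> and \<open>null3\<close> have exactly this shape, so with it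
  multilinearity and compatibility with the relations can be matched literally.
\<close>

lemma linear_iff_combination:
  "Vector_Spaces.linear s sw f \<longleftrightarrow>
    vector_space s \<and> vector_space sw \<and> (\<forall>c x y. f (s c x + y) = sw c (f x) + f y)"
  (is "?L \<longleftrightarrow> ?R")
proof
  assume ?L
  then show ?R
    by (auto simp: Vector_Spaces.linear_iff)
next
  assume R: ?R
  interpret V: vector_space s using R by blast
  interpret W: vector_space sw using R by blast
  have add: "f (x + y) = f x + f y" for x y
    using R[THEN conjunct2, THEN conjunct2, rule_format, of 1 x y] by simp
  have "f 0 = 0"
    using add[of 0 0] by simp
  then have "f (s c x) = sw c (f x)" for c x
    using R[THEN conjunct2, THEN conjunct2, rule_format, of c x 0] by simp
  with R add show ?L
    by (simp add: Vector_Spaces.linear_iff)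
qed

lemma subspace_null2: "free_subspace (null2 s)"
  unfolding null2_def
  by (intro module.subspace_span vector_space_free_scale[folded module_iff_vector_space])

lemma subspace_null3: "free_subspace (null3 s)"
  unfolding null3_def
  by (intro module.subspace_span vector_space_free_scale[folded module_iff_vector_space])

lemma descends_span:
  "descends (module.span free_scale G) sw f \<longleftrightarrow> vector_space sw \<and> (\<forall>q\<in>G. lin_ext sw f q = 0)"
proof (cases "vector_space sw")
  case True
  then interpret e: Vector_Spaces.linear free_scale sw "lin_ext sw f"
    by (rule lin_ext_linear)
  have "lin_ext sw f q = 0" if "q \<in> e.vs1.span G" "\<forall>q\<in>G. lin_ext sw f q = 0" for q
    using that by (intro e.eq_0_on_span[of G q]) auto
  with True show ?thesis
    by (auto simp: descends_def e.vs1.span_base)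
qed (simp add: descends_def)

text \<open>
  The universal property of the tensor square, in both directions. The direction from left to right
  is what turns an arbitrary linear form on the quotient into a bilinear form when equations between
  tensors are tested.
\<close>

lemma descends_null2:
  assumes "vector_space s" "vector_space sw"
  shows "descends (null2 s) sw (\<lambda>(x, y). f x y) \<longleftrightarrow> bilinear s sw f"
proof -
  interpret e: Vector_Spaces.linear free_scale sw "lin_ext sw (\<lambda>(x, y). f x y)"
    by (rule lin_ext_linear) fact
  have ball: "(\<forall>q\<in>{t c x y z | c x y z. True}. P q) \<longleftrightarrow> (\<forall>c x y z. P (t c x y z))"
    for t :: "'a \<Rightarrow> 'b \<Rightarrow> 'b \<Rightarrow> 'b \<Rightarrow> 'b \<times> 'b \<Rightarrow>\<^sub>0 'a" and P
    by blast
  show ?thesis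
    unfolding null2_def descends_span ball_Un ball bilinear_def linear_iff_combination
      e.diff e.add e.scale lin_ext_gen[OF assms(2)] diff_diff_add right_minus_eq
    using assms by auto
qed

lemma descends_null3:
  assumes "vector_space s" "vector_space sw"
  shows "descends (null3 s) sw (\<lambda>(x, y, z). f x y z) \<longleftrightarrow> trilinear s sw f"
proof -
  interpret e: Vector_Spaces.linear free_scale sw "lin_ext sw (\<lambda>(x, y, z). f x y z)"
    by (rule lin_ext_linear) fact
  have ball: "(\<forall>q\<in>{t c x y z w | c x y z w. True}. P q) \<longleftrightarrow> (\<forall>c x y z w. P (t c x y z w))"
    for t :: "'a \<Rightarrow> 'b \<Rightarrow> 'b \<Rightarrow> 'b \<Rightarrow> 'b \<Rightarrow> 'b \<times> 'b \<times> 'b \<Rightarrow>\<^sub>0 'a" and P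
    by blast
  show ?thesis
    unfolding null3_def descends_span ball_Un ball trilinear_def linear_iff_combination
      e.diff e.add e.scale lin_ext_gen[OF assms(2)] diff_diff_add right_minus_eq
    using assms by auto
qed

section \<open>Evaluating multilinear maps on tensors\<close>

text \<open>
  For multilinear \<open>f\<close>, the term \<open>eval2 sw f (\<Delta> x)\<close> is what Sweedler notation writes as \<open>f\<close>
  applied to the two legs of \<open>\<Delta>(x)\<close>. The rules below rewrite each operation on tensors into
  iterated evaluations.
\<close>

lemma bilinear_descends: "bilinear s sw f \<Longrightarrow> descends (null2 s) sw (\<lambda>(x, y). f x y)"
  by (subst descends_null2) (auto simp: bilinear_def Vector_Spaces.linear_iff)

lemma trilinear_descends: "trilinear s sw f \<Longrightarrow> descends (null3 s) sw (\<lambda>(x, y, z). f x y z)"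
  by (subst descends_null3) (auto simp: trilinear_def Vector_Spaces.linear_iff)

lemma eval2_pure2: "bilinear s sw f \<Longrightarrow> eval2 sw f (pure2 s x y) = f x y"
  using lift_val_coset[OF subspace_null2 bilinear_descends, of s sw f "gen (x, y)"]
  by (simp add: pure2_def lin_ext_gen bilinear_def Vector_Spaces.linear_iff)

lemma eval3_pure3: "trilinear s sw f \<Longrightarrow> eval3 sw f (pure3 s x y z) = f x y z"
  using lift_val_coset[OF subspace_null3 trilinear_descends, of s sw f "gen (x, y, z)"]
  by (simp add: pure3_def lin_ext_gen trilinear_def Vector_Spaces.linear_iff)

lemma eval2_quot_add:
  "bilinear s sw f \<Longrightarrow> eval2 sw f (quot_add (null2 s) X Y) = eval2 sw f X + eval2 sw f Y"
  by (intro lift_val_quot_add subspace_null2 bilinear_descends)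

lemma eval2_quot_scale:
  "bilinear s sw f \<Longrightarrow> eval2 sw f (quot_scale (null2 s) c X) = sw c (eval2 sw f X)"
  by (intro lift_val_quot_scale subspace_null2 bilinear_descends)

lemma eval2_lift_quot:
  "bilinear s sw f \<Longrightarrow>
    eval2 sw f (lift_quot (null2 s) g X) = lift_val sw (\<lambda>a. eval2 sw f (g a)) X"
  by (intro lift_val_lift_quot subspace_null2 bilinear_descends)

lemma eval3_lift_quot:
  "trilinear s sw f \<Longrightarrow>
    eval3 sw f (lift_quot (null3 s) g X) = lift_val sw (\<lambda>a. eval3 sw f (g a)) X"
  by (intro lift_val_lift_quot subspace_null3 trilinear_descends)

lemma eval2_mult2:
  "bilinear s sw f \<Longrightarrow> eval2 sw f (mult2 s m X Y) =
    eval2 sw (\<lambda>x y. eval2 sw (\<lambda>x' y'. f (m x x') (m y y')) Y) X"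
  using eval2_pure2[of s sw f]
  by (simp add: mult2_def eval2_lift_quot split_beta) (simp add: case_prod_unfold)

lemma eval2_incl2:
  "bilinear (adj_scale s) sw f \<Longrightarrow>
    eval2 sw f (incl2 s X) = eval2 sw (\<lambda>x y. f (incl x) (incl y)) X"
  using eval2_pure2[of "adj_scale s" sw f]
  by (simp add: incl2_def eval2_lift_quot split_beta) (simp add: case_prod_unfold)

lemma eval3_append_right:
  "trilinear s sw f \<Longrightarrow> eval3 sw f (append_right s X z) = eval2 sw (\<lambda>x y. f x y z) X"
  using eval3_pure3[of s sw f]
  by (simp add: append_right_def eval3_lift_quot split_beta) (simp add: case_prod_unfold)

lemma eval3_append_left:
  "trilinear s sw f \<Longrightarrow> eval3 sw f (append_left s x Y) = eval2 sw (f x) Y"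
  using eval3_pure3[of s sw f]
  by (simp add: append_left_def eval3_lift_quot split_beta) (simp add: case_prod_unfold)

lemma eval3_tensor_id_right:
  "trilinear s sw f \<Longrightarrow> eval3 sw f (tensor_id_right s D X) =
    eval2 sw (\<lambda>x y. eval2 sw (\<lambda>a b. f a b y) (D x)) X"
  using eval3_append_right[of s sw f]
  by (simp add: tensor_id_right_def eval3_lift_quot split_beta) (simp add: case_prod_unfold)

lemma eval3_tensor_id_left:
  "trilinear s sw f \<Longrightarrow> eval3 sw f (tensor_id_left s D X) =
    eval2 sw (\<lambda>x y. eval2 sw (f x) (D y)) X"
  using eval3_append_left[of s sw f]
  by (simp add: tensor_id_left_def eval3_lift_quot split_beta) (simp add: case_prod_unfold)

lemma eval3_mult3:
  "trilinear s sw f \<Longrightarrow> eval3 sw f (mult3 s m X Y) =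
    eval3 sw (\<lambda>x y z. eval3 sw (\<lambda>x' y' z'. f (m x x') (m y y') (m z z')) Y) X"
  using eval3_pure3[of s sw f]
  by (simp add: mult3_def eval3_lift_quot split_beta) (simp add: case_prod_unfold)

text \<open>
  Scalar-valued bilinear forms suffice to tell tensors apart. With this, every axiom that equates two
  tensors becomes an identity of scalars.
\<close>

lemma tensor2_eqI:
  fixes s :: "'k::field \<Rightarrow> 'v::ab_group_add \<Rightarrow> 'v"
  assumes "vector_space s" "X \<in> tensor2 s" "Y \<in> tensor2 s"
    and "\<And>f :: 'v \<Rightarrow> 'v \<Rightarrow> 'k. bilinear s (*) f \<Longrightarrow> eval2 (*) f X = eval2 (*) f Y"
  shows "X = Y"
proof (rule quot_eqI[OF subspace_null2 assms(2,3)])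
  fix f :: "'v \<times> 'v \<Rightarrow> 'k"
  assume "descends (null2 s) (*) f"
  then have "bilinear s (*) (\<lambda>x y. f (x, y))"
    using descends_null2[OF assms(1) vector_space_field, of "\<lambda>x y. f (x, y)"] by simp
  from assms(4)[OF this] show "lift_val (*) f X = lift_val (*) f Y"
    by simp
qed

lemma tensor3_eqI:
  fixes s :: "'k::field \<Rightarrow> 'v::ab_group_add \<Rightarrow> 'v"
  assumes "vector_space s" "X \<in> quot (null3 s)" "Y \<in> quot (null3 s)"
    and "\<And>f :: 'v \<Rightarrow> 'v \<Rightarrow> 'v \<Rightarrow> 'k. trilinear s (*) f \<Longrightarrow> eval3 (*) f X = eval3 (*) f Y"
  shows "X = Y"
proof (rule quot_eqI[OF subspace_null3 assms(2,3)])
  fix f :: "'v \<times> 'v \<times> 'v \<Rightarrow> 'k"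
  assume "descends (null3 s) (*) f"
  then have "trilinear s (*) (\<lambda>x y z. f (x, y, z))"
    using descends_null3[OF assms(1) vector_space_field, of "\<lambda>x y z. f (x, y, z)"] by simp
  from assms(4)[OF this] show "lift_val (*) f X = lift_val (*) f Y"
    by simp
qed

lemma in_tensor [simp]:
  "coset N p \<in> quot N" "lift_quot N g X \<in> quot N" "quot_add N X Y \<in> quot N"
  "quot_scale N c X \<in> quot N" "mult2 s m X' Y' \<in> quot (null2 s)"
  "tensor_id_left s D X' \<in> quot (null3 s)" "tensor_id_right s D X' \<in> quot (null3 s)"
  "mult3 s m X'' Y'' \<in> quot (null3 s)"
  by (auto simp: quot_def lift_quot_def quot_add_def quot_scale_def mult2_def mult3_def
      tensor_id_left_def tensor_id_right_def)

lemma linear_eval2: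
  "Vector_Spaces.linear s1 s2 h \<Longrightarrow> h (eval2 s1 f X) = eval2 s2 (\<lambda>x y. h (f x y)) X"
  by (simp add: linear_lift_val case_prod_unfold)

text \<open>
  These rules supply the linearity in the free arguments of an iterated evaluation, which the
  evaluation of its outer layer requires.
\<close>

lemma linear_lift_val_integrand:
  assumes "\<And>a. Vector_Spaces.linear s sw (\<lambda>x. f x a)"
  shows "Vector_Spaces.linear s sw (\<lambda>x. lift_val sw (f x) X)"
proof -
  interpret L: Vector_Spaces.linear s sw "\<lambda>x. f x a" for a by (rule assms)
  show ?thesis
    unfolding Vector_Spaces.linear_iff
  proof (intro conjI allI L.vs1.vector_space_axioms L.vs2.vector_space_axioms)
    have "f (x + y) = (\<lambda>a. f x a + f y a)" for x y
      by (rule ext) (rule L.add)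
    then show "lift_val sw (f (x + y)) X = lift_val sw (f x) X + lift_val sw (f y) X" for x y
      by (simp add: lift_val_add L.vs2.vector_space_axioms)
    have "f (s c x) = (\<lambda>a. sw c (f x a))" for c x
      by (rule ext) (rule L.scale)
    then show "lift_val sw (f (s c x)) X = sw c (lift_val sw (f x) X)" for c x
      by (simp add: linear_lift_val[OF L.vs2.linear_scale_self])
  qed
qed

lemma linear_eval2_integrand:
  "(\<And>a b. Vector_Spaces.linear s sw (\<lambda>x. f x a b)) \<Longrightarrow>
    Vector_Spaces.linear s sw (\<lambda>x. eval2 sw (f x) X)"
  by (rule linear_lift_val_integrand) auto

lemma linear_compose:
  "Vector_Spaces.linear s sw f \<Longrightarrow> Vector_Spaces.linear r s g \<Longrightarrow>
    Vector_Spaces.linear r sw (\<lambda>x. f (g x))"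
  by (simp add: Vector_Spaces.linear_iff)

lemma bilinear_compose:
  "bilinear s sw f \<Longrightarrow> Vector_Spaces.linear r s g \<Longrightarrow> Vector_Spaces.linear r s h \<Longrightarrow>
    bilinear r sw (\<lambda>x y. f (g x) (h y))"
  by (simp add: bilinear_def Vector_Spaces.linear_iff)

lemma trilinear_compose:
  "trilinear s sw f \<Longrightarrow> Vector_Spaces.linear r s g \<Longrightarrow> Vector_Spaces.linear r s h \<Longrightarrow>
    Vector_Spaces.linear r s k \<Longrightarrow> trilinear r sw (\<lambda>x y z. f (g x) (h y) (k z))"
  by (simp add: trilinear_def Vector_Spaces.linear_iff)

lemma trilinear_bilinear:
  assumes "trilinear s sw f"
  shows "bilinear s sw (f x)" "bilinear s sw (\<lambda>x z. f x y z)" "bilinear s sw (\<lambda>x y. f x y z)"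
  using assms by (auto simp: trilinear_def bilinear_def)

lemma bilinear_eval2_integrand:
  "(\<And>a b. bilinear s sw (\<lambda>x y. f x y a b)) \<Longrightarrow>
    bilinear s sw (\<lambda>x y. eval2 sw (f x y) X)"
  by (simp add: bilinear_def linear_eval2_integrand)

lemma trilinear_eval3_integrand:
  assumes "\<And>a b c. trilinear s sw (\<lambda>x y z. f x y z a b c)"
  shows "trilinear s sw (\<lambda>x y z. eval3 sw (f x y z) X)"
  using assms unfolding trilinear_def by (auto intro!: linear_lift_val_integrand)

lemma linear_eval2_comult:
  assumes "counital_coalgebra s \<Delta> \<epsilon>" "bilinear s sw f"
  shows "Vector_Spaces.linear s sw (\<lambda>x. eval2 sw f (\<Delta> x))"
proof -
  interpret counital_coalgebra s \<Delta> \<epsilon> by fact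
  show ?thesis
    using assms(2) vector_space_axioms
    by (simp add: Vector_Spaces.linear_iff comult_add comult_scale eval2_quot_add eval2_quot_scale)
      (simp add: bilinear_def Vector_Spaces.linear_iff)
qed

lemma vector_space_adj_scale: "vector_space s \<Longrightarrow> vector_space (adj_scale s)"
  unfolding vector_space_def adj_scale_def by (auto simp: algebra_simps)

lemma bilinear_swap: "bilinear s sw f \<Longrightarrow> bilinear s sw (\<lambda>x y. f y x)"
  by (simp add: bilinear_def)

lemma bilinear_scale:
  "Vector_Spaces.linear s (*) g \<Longrightarrow> Vector_Spaces.linear s sw h \<Longrightarrow>
    bilinear s sw (\<lambda>x y. sw (g x) (h y))"
  by (simp add: bilinear_def Vector_Spaces.linear_iff vector_space_def mult.commute)

section \<open>The decomposition of the algebra with adjoined unit\<close>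

context hopf_algebra
begin

text \<open>
  The element \<open>x + a e\<^sub>0\<close>, where \<open>e\<^sub>0 = e\<^sub>1 - e\<close> is the complement of the old unit \<open>e\<close>. In the
  coordinates along \<open>H\<close> and \<open>e\<^sub>1\<close> this is \<open>(x - a e, a)\<close>. Since \<open>e\<^sub>0\<close> is an idempotent that
  annihilates \<open>H\<close>, all operations are componentwise in these new coordinates.
\<close>

definition dsum :: "'v \<Rightarrow> 'k \<Rightarrow> 'v \<times> 'k"
  where "dsum x a = (x - s a e, a)"

lemma dsum_cases:
  obtains x a where "u = dsum x a"
proof
  show "u = dsum (fst u + s (snd u) e) (snd u)"
    by (simp add: dsum_def)
qed

lemma incl_dsum: "incl x = dsum x 0"
  by (simp add: incl_def dsum_def)

lemma adj_unit_dsum: "adj_unit = dsum e 1"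
  by (simp add: adj_unit_def dsum_def)

lemma dsum_add: "dsum x a + dsum y b = dsum (x + y) (a + b)"
  by (simp add: dsum_def scale_left_distrib)

lemma dsum_scale: "adj_scale s c (dsum x a) = dsum (s c x) (c * a)"
  by (simp add: dsum_def adj_scale_def scale_right_diff_distrib)

lemma m_add: "m (x + y) z = m x z + m y z" "m z (x + y) = m z x + m z y"
  using mult_linear_left mult_linear_right by (simp_all add: Vector_Spaces.linear_iff)

lemma m_scale: "m (s c x) y = s c (m x y)" "m x (s c y) = s c (m x y)"
  using mult_linear_left mult_linear_right by (simp_all add: Vector_Spaces.linear_iff)

lemma m_zero: "m 0 y = 0" "m x 0 = 0"
  using m_scale(1)[of 0 0 y] m_scale(2)[of x 0 0] by simp_all

lemma m_diff: "m (x - y) z = m x z - m y z" "m z (x - y) = m z x - m z y"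
  using m_add(1)[of "x - y" y z] m_add(2)[of z "x - y" y] by simp_all

lemma counit_simps: "\<epsilon> (x + y) = \<epsilon> x + \<epsilon> y" "\<epsilon> (s c x) = c * \<epsilon> x"
  using counit_linear by (simp_all add: Vector_Spaces.linear_iff)

lemma antipode_simps: "S (x + y) = S x + S y" "S (s c x) = s c (S x)"
  using antipode_linear by (simp_all add: Vector_Spaces.linear_iff)

lemma counit_zero: "\<epsilon> 0 = 0"
  using counit_simps(2)[of 0 0] by simp

lemma antipode_zero: "S 0 = 0"
  using antipode_simps(2)[of 0 0] by simp

lemma bilinear_m: "bilinear s s m"
  by (simp add: bilinear_def mult_linear_left mult_linear_right)

text \<open>
  Apply the antipode axiom to \<open>e\<close>, which is grouplike. This is what makes \<open>S(e\<^sub>1) = e\<^sub>1\<close> the same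
  prescription as \<open>S(e\<^sub>0) = e\<^sub>0\<close>.
\<close>

lemma antipode_unit: "S e = e"
proof -
  have "bilinear s s (\<lambda>a b. m (S a) b)"
    by (rule bilinear_compose[OF bilinear_m antipode_linear linear_id[unfolded id_def]])
  then show ?thesis
    using antipode_left[of e] by (simp add: comult_unit counit_unit mult_unit_right eval2_pure2)
qed

lemma adj_mult_dsum: "adj_mult s m (dsum x a) (dsum y b) = dsum (m x y) (a * b)"
  by (simp add: adj_mult_def dsum_def m_diff m_scale mult_unit_left mult_unit_right
      scale_right_diff_distrib algebra_simps)

lemma adj_counit_dsum: "adj_counit \<epsilon> (dsum x a) = \<epsilon> x + a"
  using counit_simps(1)[of "x - s a e" "s a e"]
  by (simp add: adj_counit_def dsum_def counit_simps(2) counit_unit)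

lemma adj_antipode_dsum: "adj_antipode s S (dsum x a) = dsum (S x) a"
  using antipode_simps(1)[of "x - s a e" "s a e"]
  by (simp add: adj_antipode_def dsum_def antipode_simps(2) antipode_unit incl_def adj_unit_def
      adj_scale_def)

lemma linear_adj_iff:
  "Vector_Spaces.linear (adj_scale s) sw g \<longleftrightarrow> vector_space sw \<and>
    (\<forall>x a y b. g (dsum (x + y) (a + b)) = g (dsum x a) + g (dsum y b)) \<and>
    (\<forall>c x a. g (dsum (s c x) (c * a)) = sw c (g (dsum x a)))"
  unfolding Vector_Spaces.linear_iff dsum_add[symmetric] dsum_scale[symmetric]
  using vector_space_adj_scale[OF vector_space_axioms] dsum_cases by metis

lemma linear_dsum: "Vector_Spaces.linear s (adj_scale s) (\<lambda>x. dsum x 0)"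
  using vector_space_adj_scale[OF vector_space_axioms] vector_space_axioms
  by (simp add: Vector_Spaces.linear_iff dsum_add dsum_scale)

text \<open>
  The comultiplication splits: \<open>\<Delta>(x + a e\<^sub>0) = \<Delta>(x) + a e\<^sub>0 \<otimes> e\<^sub>0\<close>. Indeed the prescribed
  \<open>\<Delta>(e\<^sub>1)\<close> is \<open>e\<^sub>0 \<otimes> e\<^sub>0 + e \<otimes> e\<close>, and \<open>e \<otimes> e = \<Delta>(e)\<close>, so \<open>e\<^sub>0\<close> is grouplike.
\<close>

lemma eval2_adj_comult_dsum:
  assumes f: "bilinear (adj_scale s) sw f"
  shows "eval2 sw f (adj_comult s e \<Delta> (dsum x a)) =
    eval2 sw (\<lambda>x y. f (dsum x 0) (dsum y 0)) (\<Delta> x) + sw a (f (dsum 0 1) (dsum 0 1))"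
proof -
  have dd: "bilinear s sw (\<lambda>x y. f (dsum x 0) (dsum y 0))"
    by (rule bilinear_compose[OF f linear_dsum linear_dsum])
  interpret L: Vector_Spaces.linear s sw "\<lambda>x. eval2 sw (\<lambda>x y. f (dsum x 0) (dsum y 0)) (\<Delta> x)"
    by (rule linear_eval2_comult[OF counital_coalgebra_axioms dd])
  have f_e: "adj_unit - dsum e 0 = dsum 0 1"
    by (simp add: adj_unit_def dsum_def)
  show ?thesis
    using dd f
    by (simp add: dsum_def[of x a] adj_comult_def adj_comult_unit_def eval2_quot_add
        eval2_quot_scale eval2_incl2 eval2_pure2 f_e incl_dsum L.diff L.scale comult_unit
        L.vs2.scale_right_distrib)
qed

section \<open>The weak Hopf algebra axioms\<close>

lemma adj_unital_algebra: "unital_algebra (adj_scale s) (adj_mult s m) adj_unit"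
proof -
  interpret H': vector_space "adj_scale s"
    by (rule vector_space_adj_scale[OF vector_space_axioms])
  show ?thesis
  proof (intro unital_algebra.intro unital_algebra_axioms.intro H'.vector_space_axioms)
    show "Vector_Spaces.linear (adj_scale s) (adj_scale s) (\<lambda>u. adj_mult s m u v)" for v
      by (rule dsum_cases[of v])
        (simp add: linear_adj_iff H'.vector_space_axioms adj_mult_dsum dsum_add dsum_scale m_add
          m_scale algebra_simps)
    show "Vector_Spaces.linear (adj_scale s) (adj_scale s) (adj_mult s m u)" for u
      by (rule dsum_cases[of u])
        (simp add: linear_adj_iff H'.vector_space_axioms adj_mult_dsum dsum_add dsum_scale m_add
          m_scale algebra_simps)
    show "adj_mult s m (adj_mult s m u v) w = adj_mult s m u (adj_mult s m v w)" for u v w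
      by (rule dsum_cases[of u], rule dsum_cases[of v], rule dsum_cases[of w])
        (simp add: adj_mult_dsum mult_assoc mult.assoc)
    show "adj_mult s m adj_unit u = u" "adj_mult s m u adj_unit = u" for u
      by (rule dsum_cases[of u],
          simp add: adj_unit_dsum adj_mult_dsum mult_unit_left mult_unit_right)+
  qed
qed

lemma bilinear_adj_mult: "bilinear (adj_scale s) (adj_scale s) (adj_mult s m)"
proof -
  interpret H': unital_algebra "adj_scale s" "adj_mult s m" adj_unit
    by (rule adj_unital_algebra)
  show ?thesis
    by (simp add: bilinear_def H'.mult_linear_left H'.mult_linear_right)
qed

lemma adj_counit_linear: "Vector_Spaces.linear (adj_scale s) (*) (adj_counit \<epsilon>)"
  by (simp add: linear_adj_iff vector_space_field adj_counit_dsum counit_simps algebra_simps)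

lemma adj_antipode_linear: "Vector_Spaces.linear (adj_scale s) (adj_scale s) (adj_antipode s S)"
  by (simp add: linear_adj_iff vector_space_adj_scale vector_space_axioms adj_antipode_dsum
      antipode_simps dsum_add dsum_scale)

lemma linear_eval2_adj_comult:
  assumes "bilinear (adj_scale s) sw f"
  shows "Vector_Spaces.linear (adj_scale s) sw (\<lambda>u. eval2 sw f (adj_comult s e \<Delta> u))"
proof -
  have dd: "bilinear s sw (\<lambda>x y. f (dsum x 0) (dsum y 0))"
    by (rule bilinear_compose[OF assms linear_dsum linear_dsum])
  interpret L: Vector_Spaces.linear s sw "\<lambda>x. eval2 sw (\<lambda>x y. f (dsum x 0) (dsum y 0)) (\<Delta> x)"
    by (rule linear_eval2_comult[OF counital_coalgebra_axioms dd])
  show ?thesis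
    by (simp add: linear_adj_iff L.vs2.vector_space_axioms eval2_adj_comult_dsum[OF assms]
        L.add L.scale L.vs2.scale_left_distrib L.vs2.scale_right_distrib ac_simps)
qed

lemma eval2_adj_comult_incl:
  assumes "bilinear (adj_scale s) sw f"
  shows "eval2 sw f (adj_comult s e \<Delta> (dsum x 0)) =
    eval2 sw (\<lambda>x y. f (dsum x 0) (dsum y 0)) (\<Delta> x)"
proof -
  interpret W: vector_space sw
    using assms by (simp add: bilinear_def Vector_Spaces.linear_iff)
  show ?thesis
    by (simp add: eval2_adj_comult_dsum[OF assms])
qed

lemma eval2_adj_comult_compl:
  assumes "bilinear (adj_scale s) sw f"
  shows "eval2 sw f (adj_comult s e \<Delta> (dsum 0 1)) = f (dsum 0 1) (dsum 0 1)"
proof -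
  have dd: "bilinear s sw (\<lambda>x y. f (dsum x 0) (dsum y 0))"
    by (rule bilinear_compose[OF assms linear_dsum linear_dsum])
  interpret L: Vector_Spaces.linear s sw "\<lambda>x. eval2 sw (\<lambda>x y. f (dsum x 0) (dsum y 0)) (\<Delta> x)"
    by (rule linear_eval2_comult[OF counital_coalgebra_axioms dd])
  show ?thesis
    by (simp add: eval2_adj_comult_dsum[OF assms] L.zero)
qed

lemma eval2_adj_comult_unit:
  assumes "bilinear (adj_scale s) sw f"
  shows "eval2 sw f (adj_comult s e \<Delta> adj_unit) =
    f (dsum e 0) (dsum e 0) + f (dsum 0 1) (dsum 0 1)"
proof -
  have dd: "bilinear s sw (\<lambda>x y. f (dsum x 0) (dsum y 0))"
    by (rule bilinear_compose[OF assms linear_dsum linear_dsum])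
  interpret W: vector_space sw
    using assms by (simp add: bilinear_def Vector_Spaces.linear_iff)
  show ?thesis
    using dd by (simp add: adj_unit_dsum eval2_adj_comult_dsum[OF assms] comult_unit eval2_pure2)
qed

text \<open>
  The two maps are the inner layers of \<open>(\<Delta> \<otimes> id) \<Delta>\<close> and \<open>(id \<otimes> \<Delta>) \<Delta>\<close>; bilinearity
  lets the splitting of \<open>\<Delta>\<close> be applied to the outer layer as well.
\<close>

lemma trilinear_adj_comult:
  assumes "trilinear (adj_scale s) sw f"
  shows "bilinear (adj_scale s) sw (\<lambda>x y. eval2 sw (\<lambda>a b. f a b y) (adj_comult s e \<Delta> x))"
    and "bilinear (adj_scale s) sw (\<lambda>x y. eval2 sw (f x) (adj_comult s e \<Delta> y))"
  using assms unfolding bilinear_def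
  by (auto intro!: linear_eval2_adj_comult linear_eval2_integrand trilinear_bilinear
      simp: trilinear_def)

text \<open>
  After both layers of \<open>\<Delta>\<close> are split, coassociativity and the counit laws hold in \<open>H\<close> by assumption
  and on \<open>e\<^sub>0\<close> because \<open>e\<^sub>0\<close> is grouplike with counit \<open>1\<close>.
\<close>

lemma adj_counital_coalgebra:
  "counital_coalgebra (adj_scale s) (adj_comult s e \<Delta>) (adj_counit \<epsilon>)"
proof -
  let ?D = "adj_comult s e \<Delta>"
  interpret H': vector_space "adj_scale s"
    by (rule vector_space_adj_scale[OF vector_space_axioms])
  have closed: "?D u \<in> tensor2 (adj_scale s)" for u
    by (cases u) (simp add: adj_comult_def)
  show ?thesis
  proof (intro counital_coalgebra.intro counital_coalgebra_axioms.intro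
      H'.vector_space_axioms)
    fix u v :: "'v \<times> 'k" and c :: 'k
    show "?D u \<in> tensor2 (adj_scale s)"
      by (rule closed)
    show "?D (u + v) = quot_add (null2 (adj_scale s)) (?D u) (?D v)"
    proof (rule tensor2_eqI[OF H'.vector_space_axioms closed])
      fix f :: "'v \<times> 'k \<Rightarrow> 'v \<times> 'k \<Rightarrow> 'k"
      assume f: "bilinear (adj_scale s) (*) f"
      show "eval2 (*) f (?D (u + v)) =
        eval2 (*) f (quot_add (null2 (adj_scale s)) (?D u) (?D v))"
        by (simp add: eval2_quot_add[OF f]
            module_hom.add[OF linear_eval2_adj_comult[OF f, folded module_hom_iff_linear]])
    qed simp
    show "?D (adj_scale s c u) = quot_scale (null2 (adj_scale s)) c (?D u)"
    proof (rule tensor2_eqI[OF H'.vector_space_axioms closed])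
      fix f :: "'v \<times> 'k \<Rightarrow> 'v \<times> 'k \<Rightarrow> 'k"
      assume f: "bilinear (adj_scale s) (*) f"
      show "eval2 (*) f (?D (adj_scale s c u)) =
        eval2 (*) f (quot_scale (null2 (adj_scale s)) c (?D u))"
        by (simp add: eval2_quot_scale[OF f]
            module_hom.scale[OF linear_eval2_adj_comult[OF f, folded module_hom_iff_linear]])
    qed simp
    show "Vector_Spaces.linear (adj_scale s) (*) (adj_counit \<epsilon>)"
      by (rule adj_counit_linear)
    show "tensor_id_right (adj_scale s) ?D (?D u) = tensor_id_left (adj_scale s) ?D (?D u)"
    proof (rule tensor3_eqI[OF H'.vector_space_axioms])
      fix f :: "'v \<times> 'k \<Rightarrow> 'v \<times> 'k \<Rightarrow> 'v \<times> 'k \<Rightarrow> 'k"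
      assume f: "trilinear (adj_scale s) (*) f"
      obtain x a where u: "u = dsum x a" by (rule dsum_cases)
      have fH: "trilinear s (*) (\<lambda>x y z. f (dsum x 0) (dsum y 0) (dsum z 0))"
        by (rule trilinear_compose[OF f linear_dsum linear_dsum linear_dsum])
      show "eval3 (*) f (tensor_id_right (adj_scale s) ?D (?D u)) =
        eval3 (*) f (tensor_id_left (adj_scale s) ?D (?D u))"
        using eval3_tensor_id_right[OF fH, of \<Delta> "\<Delta> x"] eval3_tensor_id_left[OF fH, of \<Delta> "\<Delta> x"]
        by (simp add: u coassoc eval3_tensor_id_right[OF f] eval3_tensor_id_left[OF f]
          eval2_adj_comult_dsum[OF trilinear_adj_comult(1)[OF f]]
          eval2_adj_comult_dsum[OF trilinear_adj_comult(2)[OF f]]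
          eval2_adj_comult_incl[OF trilinear_bilinear(1)[OF f]]
          eval2_adj_comult_incl[OF trilinear_bilinear(3)[OF f]]
          eval2_adj_comult_compl[OF trilinear_bilinear(1)[OF f]]
          eval2_adj_comult_compl[OF trilinear_bilinear(3)[OF f]])
    qed simp_all
    obtain x a where u: "u = dsum x a" by (rule dsum_cases)
    have "eval2 (adj_scale s) (\<lambda>p q. dsum (s (\<epsilon> p) q) 0) (\<Delta> x) = dsum x 0"
      using linear_eval2[OF linear_dsum, of "\<lambda>p q. s (\<epsilon> p) q" "\<Delta> x"]
      by (simp add: counit_left)
    then show "eval2 (adj_scale s) (\<lambda>p q. adj_scale s (adj_counit \<epsilon> p) q) (?D u) = u"
      by (simp add: u eval2_adj_comult_dsum[OF bilinear_scale[OF adj_counit_linear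
        H'.linear_id[unfolded id_def]]] adj_counit_dsum counit_zero dsum_scale dsum_add)
    have "eval2 (adj_scale s) (\<lambda>p q. dsum (s (\<epsilon> q) p) 0) (\<Delta> x) = dsum x 0"
      using linear_eval2[OF linear_dsum, of "\<lambda>p q. s (\<epsilon> q) p" "\<Delta> x"]
      by (simp add: counit_right)
    then show "eval2 (adj_scale s) (\<lambda>p q. adj_scale s (adj_counit \<epsilon> q) p) (?D u) = u"
      by (simp add: u eval2_adj_comult_dsum[OF bilinear_swap[OF bilinear_scale[OF adj_counit_linear
        H'.linear_id[unfolded id_def]]]] adj_counit_dsum counit_zero dsum_scale dsum_add)
  qed
qed

lemma bilinear_zero:
  assumes "bilinear (adj_scale s) sw f"
  shows "f (dsum 0 0) v = 0" "f u (dsum 0 0) = 0"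
proof -
  have "dsum 0 0 = (0 :: 'v \<times> 'k)"
    by (simp add: dsum_def zero_prod_def)
  moreover have "module_hom (adj_scale s) sw (\<lambda>x. f x v)" "module_hom (adj_scale s) sw (f u)"
    using assms unfolding bilinear_def module_hom_iff_linear by blast+
  ultimately show "f (dsum 0 0) v = 0" "f u (dsum 0 0) = 0"
    using module_hom.zero by fastforce+
qed

text \<open>
  The mixed terms, in which a leg in \<open>H\<close> meets \<open>e\<^sub>0\<close>, vanish; what is left is multiplicativity of
  \<open>\<Delta>\<close> on \<open>H\<close> and \<open>(e\<^sub>0 \<otimes> e\<^sub>0)(e\<^sub>0 \<otimes> e\<^sub>0) = e\<^sub>0 \<otimes> e\<^sub>0\<close>.
\<close>

lemma adj_comult_mult:
  "adj_comult s e \<Delta> (adj_mult s m u v) =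
    mult2 (adj_scale s) (adj_mult s m) (adj_comult s e \<Delta> u) (adj_comult s e \<Delta> v)"
proof (rule tensor2_eqI[OF vector_space_adj_scale[OF vector_space_axioms]])
  interpret C: counital_coalgebra "adj_scale s" "adj_comult s e \<Delta>" "adj_counit \<epsilon>"
    by (rule adj_counital_coalgebra)
  show "adj_comult s e \<Delta> (adj_mult s m u v) \<in> tensor2 (adj_scale s)"
    by (rule C.comult_closed)
next
  fix f :: "'v \<times> 'k \<Rightarrow> 'v \<times> 'k \<Rightarrow> 'k"
  assume f: "bilinear (adj_scale s) (*) f"
  interpret A: unital_algebra "adj_scale s" "adj_mult s m" adj_unit
    by (rule adj_unital_algebra)
  obtain x a where u: "u = dsum x a" by (rule dsum_cases)
  obtain y b where v: "v = dsum y b" by (rule dsum_cases)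
  have fH: "bilinear s (*) (\<lambda>x y. f (dsum x 0) (dsum y 0))"
    by (rule bilinear_compose[OF f linear_dsum linear_dsum])
  have right: "bilinear (adj_scale s) (*) (\<lambda>p' q'. f (adj_mult s m p p') (adj_mult s m q q'))"
    for p q
    by (rule bilinear_compose[OF f A.mult_linear_right A.mult_linear_right])
  have left: "bilinear (adj_scale s) (*) (\<lambda>p q.
      eval2 (*) (\<lambda>p' q'. f (adj_mult s m p p') (adj_mult s m q q')) (adj_comult s e \<Delta> v))"
    by (intro bilinear_eval2_integrand bilinear_compose[OF f] A.mult_linear_left)
  have zero: "eval2 (*) (\<lambda>x y. 0) X = (0::'k)" for X :: "('v \<times> 'v \<Rightarrow>\<^sub>0 'k) set"
    by (simp add: lift_val_def lin_ext_def case_prod_unfold)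
  show "eval2 (*) f (adj_comult s e \<Delta> (adj_mult s m u v)) = eval2 (*) f
    (mult2 (adj_scale s) (adj_mult s m) (adj_comult s e \<Delta> u) (adj_comult s e \<Delta> v))"
    \<comment> \<open>The outer layer is evaluated first: as bilinear in the outer legs only the whole
      inner evaluation is recognised, not its expanded form.\<close>
    unfolding eval2_mult2[OF f] unfolding u eval2_adj_comult_dsum[OF left]
    unfolding v eval2_adj_comult_dsum[OF right] adj_mult_dsum eval2_adj_comult_dsum[OF f]
    using fH by (simp add: comult_mult eval2_mult2 bilinear_zero[OF f] m_zero zero)
qed simp

text \<open>
  On \<open>H\<close> the counit is multiplicative, so the right-hand side reduces to
  \<open>\<epsilon>(x) \<epsilon>(y) \<epsilon>(z)\<close> by the counit law. The whole counit is not multiplicative: it takes the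
  value \<open>2\<close> at the unit, which is the sum of two orthogonal idempotents of counit \<open>1\<close>.
\<close>

lemma adj_counit_mult:
  "adj_counit \<epsilon> (adj_mult s m (adj_mult s m u v) w) =
    eval2 (*) (\<lambda>p q. adj_counit \<epsilon> (adj_mult s m u p) * adj_counit \<epsilon> (adj_mult s m q w))
      (adj_comult s e \<Delta> v)"
proof -
  interpret A: unital_algebra "adj_scale s" "adj_mult s m" adj_unit
    by (rule adj_unital_algebra)
  obtain x a where u: "u = dsum x a" by (rule dsum_cases)
  obtain y b where v: "v = dsum y b" by (rule dsum_cases)
  obtain z c where w: "w = dsum z c" by (rule dsum_cases)
  have bil: "bilinear (adj_scale s) (*)
      (\<lambda>p q. adj_counit \<epsilon> (adj_mult s m u p) * adj_counit \<epsilon> (adj_mult s m q w))"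
    by (rule bilinear_scale[OF linear_compose[OF adj_counit_linear A.mult_linear_right]
          linear_compose[OF adj_counit_linear A.mult_linear_left]])
  have "Vector_Spaces.linear s (*) (\<lambda>t. \<epsilon> x * \<epsilon> t * \<epsilon> z)"
    by (simp add: Vector_Spaces.linear_iff vector_space_axioms vector_space_field counit_simps
        algebra_simps)
  from linear_eval2[OF this, of "\<lambda>p q. s (\<epsilon> p) q" "\<Delta> y"]
  have "eval2 (*) (\<lambda>p q. (\<epsilon> x * \<epsilon> p) * (\<epsilon> q * \<epsilon> z)) (\<Delta> y) = \<epsilon> x * \<epsilon> y * \<epsilon> z"
    by (simp add: counit_left counit_simps mult.assoc)
  then show ?thesis
    unfolding v eval2_adj_comult_dsum[OF bil]
    unfolding u w by (simp add: adj_mult_dsum adj_counit_dsum counit_mult counit_simps m_zero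
        counit_zero)
qed

text \<open>
  The iterated comultiplication of the unit and the two products of \<open>\<Delta>(1) \<otimes> 1\<close> with
  \<open>1 \<otimes> \<Delta>(1)\<close> are all \<open>e \<otimes> e \<otimes> e + e\<^sub>0 \<otimes> e\<^sub>0 \<otimes> e\<^sub>0\<close>, because \<open>e\<close> and \<open>e\<^sub>0\<close> are
  orthogonal idempotents with sum \<open>1\<close>.
\<close>

lemma eval3_adj_comult_unit:
  assumes f: "trilinear (adj_scale s) (*) f"
  shows "eval3 (*) f (tensor_id_right (adj_scale s) (adj_comult s e \<Delta>)
        (adj_comult s e \<Delta> adj_unit)) =
      f (dsum e 0) (dsum e 0) (dsum e 0) + f (dsum 0 1) (dsum 0 1) (dsum 0 1)"
    and "eval3 (*) f (mult3 (adj_scale s) (adj_mult s m)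
        (append_right (adj_scale s) (adj_comult s e \<Delta> adj_unit) adj_unit)
        (append_left (adj_scale s) adj_unit (adj_comult s e \<Delta> adj_unit))) =
      f (dsum e 0) (dsum e 0) (dsum e 0) + f (dsum 0 1) (dsum 0 1) (dsum 0 1)"
    and "eval3 (*) f (mult3 (adj_scale s) (adj_mult s m)
        (append_left (adj_scale s) adj_unit (adj_comult s e \<Delta> adj_unit))
        (append_right (adj_scale s) (adj_comult s e \<Delta> adj_unit) adj_unit)) =
      f (dsum e 0) (dsum e 0) (dsum e 0) + f (dsum 0 1) (dsum 0 1) (dsum 0 1)"
proof -
  interpret A: unital_algebra "adj_scale s" "adj_mult s m" adj_unit
    by (rule adj_unital_algebra)
  let ?M = "adj_mult s m"
  have zero: "f (dsum 0 0) v w = 0" "f u (dsum 0 0) w = 0" "f u v (dsum 0 0) = 0" for u v w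
    by (rule bilinear_zero[OF trilinear_bilinear(3)[OF f]] bilinear_zero[OF trilinear_bilinear(1)[OF f]])+
  have right: "trilinear (adj_scale s) (*) (\<lambda>x' y' z'. f (?M x x') (?M y y') (?M z z'))" for x y z
    by (rule trilinear_compose[OF f A.mult_linear_right A.mult_linear_right A.mult_linear_right])
  have left: "trilinear (adj_scale s) (*)
      (\<lambda>x y z. eval3 (*) (\<lambda>x' y' z'. f (?M x x') (?M y y') (?M z z')) Y)" for Y
    by (intro trilinear_eval3_integrand trilinear_compose[OF f] A.mult_linear_left)
  note products = adj_mult_dsum mult_unit_left mult_unit_right A.mult_unit_left A.mult_unit_right
    m_zero zero
  show "eval3 (*) f (tensor_id_right (adj_scale s) (adj_comult s e \<Delta>)
        (adj_comult s e \<Delta> adj_unit)) =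
      f (dsum e 0) (dsum e 0) (dsum e 0) + f (dsum 0 1) (dsum 0 1) (dsum 0 1)"
    using bilinear_compose[OF trilinear_bilinear(3)[OF f] linear_dsum linear_dsum]
    by (simp add: eval3_tensor_id_right[OF f]
        eval2_adj_comult_unit[OF trilinear_adj_comult(1)[OF f]]
        eval2_adj_comult_incl[OF trilinear_bilinear(3)[OF f]]
        eval2_adj_comult_compl[OF trilinear_bilinear(3)[OF f]] comult_unit eval2_pure2)
  show "eval3 (*) f (mult3 (adj_scale s) (adj_mult s m)
        (append_right (adj_scale s) (adj_comult s e \<Delta> adj_unit) adj_unit)
        (append_left (adj_scale s) adj_unit (adj_comult s e \<Delta> adj_unit))) =
      f (dsum e 0) (dsum e 0) (dsum e 0) + f (dsum 0 1) (dsum 0 1) (dsum 0 1)"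
    unfolding eval3_mult3[OF f] eval3_append_right[OF left]
      eval2_adj_comult_unit[OF trilinear_bilinear(3)[OF left]]
    unfolding eval3_append_left[OF right] eval2_adj_comult_unit[OF trilinear_bilinear(1)[OF right]]
    by (simp add: products)
  show "eval3 (*) f (mult3 (adj_scale s) (adj_mult s m)
        (append_left (adj_scale s) adj_unit (adj_comult s e \<Delta> adj_unit))
        (append_right (adj_scale s) (adj_comult s e \<Delta> adj_unit) adj_unit)) =
      f (dsum e 0) (dsum e 0) (dsum e 0) + f (dsum 0 1) (dsum 0 1) (dsum 0 1)"
    unfolding eval3_mult3[OF f] eval3_append_left[OF left]
      eval2_adj_comult_unit[OF trilinear_bilinear(1)[OF left]]
    unfolding eval3_append_right[OF right] eval2_adj_comult_unit[OF trilinear_bilinear(3)[OF right]]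
    by (simp add: products)
qed

lemma adj_weak_bialgebra: "weak_bialgebra (adj_scale s) (adj_mult s m) adj_unit
    (adj_comult s e \<Delta>) (adj_counit \<epsilon>)"
  by (intro weak_bialgebra.intro weak_bialgebra_axioms.intro adj_unital_algebra
      adj_counital_coalgebra adj_comult_mult adj_counit_mult)
    (rule tensor3_eqI[OF vector_space_adj_scale[OF vector_space_axioms]];
      simp add: eval3_adj_comult_unit)+

text \<open>
  For \<open>u = x + a e\<^sub>0\<close> both sides equal \<open>\<epsilon>(x) e + a e\<^sub>0\<close>: the left one by the antipode axiom of
  \<open>H\<close>, the right one because multiplying \<open>e \<otimes> e + e\<^sub>0 \<otimes> e\<^sub>0\<close> by \<open>u \<otimes> 1\<close> sorts the two components
  of \<open>u\<close>.
\<close>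

lemma adj_antipode_right:
  "eval2 (adj_scale s) (\<lambda>p q. adj_mult s m p (adj_antipode s S q)) (adj_comult s e \<Delta> u) =
    eval2 (adj_scale s) (\<lambda>p q. adj_scale s (adj_counit \<epsilon> p) q)
      (mult2 (adj_scale s) (adj_mult s m) (adj_comult s e \<Delta> adj_unit)
        (pure2 (adj_scale s) u adj_unit))"
proof -
  interpret A: unital_algebra "adj_scale s" "adj_mult s m" adj_unit
    by (rule adj_unital_algebra)
  let ?M = "adj_mult s m" and ?E = "adj_counit \<epsilon>" and ?S = "adj_antipode s S"
    and ?D = "adj_comult s e \<Delta>"
  obtain x a where u: "u = dsum x a" by (rule dsum_cases)
  have "eval2 (adj_scale s) (\<lambda>p q. dsum (m p (S q)) 0) (\<Delta> x) = dsum (s (\<epsilon> x) e) 0"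
    using linear_eval2[OF linear_dsum, of "\<lambda>p q. m p (S q)" "\<Delta> x"] by (simp add: antipode_right)
  then have lhs: "eval2 (adj_scale s) (\<lambda>p q. ?M p (?S q)) (?D u) = dsum (s (\<epsilon> x) e) a"
    by (simp add: u eval2_adj_comult_dsum[OF bilinear_compose[OF bilinear_adj_mult
      A.linear_id[unfolded id_def] adj_antipode_linear]] adj_mult_dsum adj_antipode_dsum
      antipode_zero dsum_scale dsum_add m_zero)
  have target: "bilinear (adj_scale s) (adj_scale s) (\<lambda>p q. adj_scale s (?E p) q)"
    by (rule bilinear_scale[OF adj_counit_linear A.linear_id[unfolded id_def]])
  have inner: "bilinear (adj_scale s) (adj_scale s)
      (\<lambda>p' q'. adj_scale s (?E (?M p p')) (?M q q'))" for p q
    by (rule bilinear_compose[OF target A.mult_linear_right A.mult_linear_right])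
  have outer: "bilinear (adj_scale s) (adj_scale s)
      (\<lambda>p q. adj_scale s (?E (?M p p')) (?M q q'))" for p' q'
    by (rule bilinear_compose[OF target A.mult_linear_left A.mult_linear_left])
  show ?thesis
    unfolding lhs unfolding eval2_mult2[OF target] eval2_pure2[OF inner]
      eval2_adj_comult_unit[OF outer]
    by (simp add: u A.mult_unit_right adj_mult_dsum adj_counit_dsum mult_unit_left m_zero
      counit_zero dsum_scale dsum_add)
qed

text \<open>
  The mirror image of the previous lemma: the value is again \<open>\<epsilon>(x) e + a e\<^sub>0\<close>.
\<close>

lemma adj_antipode_left:
  "eval2 (adj_scale s) (\<lambda>p q. adj_mult s m (adj_antipode s S p) q) (adj_comult s e \<Delta> u) =
    eval2 (adj_scale s) (\<lambda>p q. adj_scale s (adj_counit \<epsilon> q) p)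
      (mult2 (adj_scale s) (adj_mult s m) (pure2 (adj_scale s) adj_unit u)
        (adj_comult s e \<Delta> adj_unit))"
proof -
  interpret A: unital_algebra "adj_scale s" "adj_mult s m" adj_unit
    by (rule adj_unital_algebra)
  let ?M = "adj_mult s m" and ?E = "adj_counit \<epsilon>" and ?S = "adj_antipode s S"
    and ?D = "adj_comult s e \<Delta>"
  obtain x a where u: "u = dsum x a" by (rule dsum_cases)
  have "eval2 (adj_scale s) (\<lambda>p q. dsum (m (S p) q) 0) (\<Delta> x) = dsum (s (\<epsilon> x) e) 0"
    using linear_eval2[OF linear_dsum, of "\<lambda>p q. m (S p) q" "\<Delta> x"] by (simp add: antipode_left)
  then have lhs: "eval2 (adj_scale s) (\<lambda>p q. ?M (?S p) q) (?D u) = dsum (s (\<epsilon> x) e) a"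
    by (simp add: u eval2_adj_comult_dsum[OF bilinear_compose[OF bilinear_adj_mult
      adj_antipode_linear A.linear_id[unfolded id_def]]] adj_mult_dsum adj_antipode_dsum
      antipode_zero dsum_scale dsum_add m_zero)
  have target: "bilinear (adj_scale s) (adj_scale s) (\<lambda>p q. adj_scale s (?E q) p)"
    by (rule bilinear_swap[OF bilinear_scale[OF adj_counit_linear A.linear_id[unfolded id_def]]])
  have inner: "bilinear (adj_scale s) (adj_scale s)
      (\<lambda>p' q'. adj_scale s (?E (?M q q')) (?M p p'))" for p q
    by (rule bilinear_compose[OF target A.mult_linear_right A.mult_linear_right])
  have outer: "bilinear (adj_scale s) (adj_scale s)
      (\<lambda>p q. eval2 (adj_scale s) (\<lambda>p' q'. adj_scale s (?E (?M q q')) (?M p p')) Y)" for Y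
    by (intro bilinear_eval2_integrand bilinear_compose[OF target] A.mult_linear_left)
  show ?thesis
    \<comment> \<open>The pure tensor is now the outer factor, so it has to be evaluated before the
      inner layer is expanded.\<close>
    unfolding lhs unfolding eval2_mult2[OF target] eval2_pure2[OF outer]
    unfolding eval2_adj_comult_unit[OF inner]
    by (simp add: u A.mult_unit_left adj_mult_dsum adj_counit_dsum mult_unit_right m_zero
      counit_zero dsum_scale dsum_add)
qed

text \<open>
  In \<open>H\<close>, contracting the first two of the three legs by the antipode axiom leaves
  \<open>S\<close> of the remaining leg, weighted by the counit, which the counit law turns into \<open>S(x)\<close>. On \<open>e\<^sub>0\<close>
  everything is \<open>e\<^sub>0 e\<^sub>0 e\<^sub>0 = e\<^sub>0\<close>.
\<close>

lemma adj_antipode_triple: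
  "eval3 (adj_scale s) (\<lambda>p q r. adj_mult s m (adj_mult s m (adj_antipode s S p) q)
      (adj_antipode s S r))
    (tensor_id_right (adj_scale s) (adj_comult s e \<Delta>) (adj_comult s e \<Delta> u)) = adj_antipode s S u"
proof -
  interpret A: unital_algebra "adj_scale s" "adj_mult s m" adj_unit
    by (rule adj_unital_algebra)
  let ?M = "adj_mult s m" and ?S = "adj_antipode s S"
  obtain x a where u: "u = dsum x a" by (rule dsum_cases)
  have f: "trilinear (adj_scale s) (adj_scale s) (\<lambda>p q r. ?M (?M (?S p) q) (?S r))"
    unfolding trilinear_def
    by (intro conjI allI
        linear_compose[OF A.mult_linear_left linear_compose[OF A.mult_linear_left adj_antipode_linear]]
        linear_compose[OF A.mult_linear_left A.mult_linear_right]
        linear_compose[OF A.mult_linear_right adj_antipode_linear])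
  have contract: "eval2 (adj_scale s) (\<lambda>p q. dsum (m (m (S p) q) (S r)) 0) (\<Delta> y) =
      dsum (S (s (\<epsilon> y) r)) 0" for y r
    using linear_eval2[OF linear_compose[OF linear_dsum mult_linear_left[of "S r"]],
        of "\<lambda>p q. m (S p) q" "\<Delta> y"]
    by (simp add: antipode_left m_scale mult_unit_left antipode_simps)
  have "Vector_Spaces.linear s (adj_scale s) (\<lambda>t. dsum (S t) 0)"
    by (rule linear_compose[OF linear_dsum antipode_linear])
  from linear_eval2[OF this, of "\<lambda>p q. s (\<epsilon> p) q" "\<Delta> x"]
  have "eval2 (adj_scale s) (\<lambda>y r. dsum (S (s (\<epsilon> y) r)) 0) (\<Delta> x) = dsum (S x) 0"
    by (simp add: counit_left)
  then show ?thesis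
    unfolding u eval3_tensor_id_right[OF f] eval2_adj_comult_dsum[OF trilinear_adj_comult(1)[OF f]]
      eval2_adj_comult_incl[OF trilinear_bilinear(3)[OF f]]
      eval2_adj_comult_compl[OF trilinear_bilinear(3)[OF f]]
    by (simp add: adj_mult_dsum adj_antipode_dsum contract m_zero antipode_zero dsum_scale dsum_add)
qed

end

theorem theorem2p12:
  fixes s :: "'k::{alg_closed_field, field_char_0} \<Rightarrow> 'h::ab_group_add \<Rightarrow> 'h"
    and m :: "'h \<Rightarrow> 'h \<Rightarrow> 'h"
    and e\<^sub>2 :: 'h
    and \<Delta> :: "'h \<Rightarrow> ('h \<times> 'h \<Rightarrow>\<^sub>0 'k) set"
    and \<epsilon> :: "'h \<Rightarrow> 'k"
    and S :: "'h \<Rightarrow> 'h"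
  assumes "hopf_algebra s m e\<^sub>2 \<Delta> \<epsilon> S"
  shows "weak_hopf_algebra (adj_scale s) (adj_mult s m) adj_unit
    (adj_comult s e\<^sub>2 \<Delta>) (adj_counit \<epsilon>) (adj_antipode s S)"
proof -
  interpret hopf_algebra s m e\<^sub>2 \<Delta> \<epsilon> S by fact
  show ?thesis
    by (intro weak_hopf_algebra.intro weak_hopf_algebra_axioms.intro adj_weak_bialgebra
        adj_antipode_linear adj_antipode_right adj_antipode_left adj_antipode_triple)
qed

end
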